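(* Every null-additive set $X\subseteq {}^{\omega}2$ is meager-additive.
   Context: ${}^{\omega}2$ is the Cantor space of infinite $0$-$1$ sequences with its usual topology. For $x,y\in{}^{\omega}2$, $x+y$ is the componentwise sum modulo 2, and for $A,B\subseteq{}^{\omega}2$, $A+B=\{a+b: a\in A, b\in B\}$. $\mu$ denotes Lebesgue measure on ${}^{\omega}2$ (the fair-coin product measure). $A\subseteq{}^\omega 2$ is null if $\mu(A)=0$. A set $X\subseteq{}^{\omega}2$ is null-additive if for every null $A\subseteq{}^{\omega}2$ the set $X+A$ is null. A set $X\subseteq{}^{\omega}2$ is meager-additive if for every meager $A\subseteq{}^{\omega}2$ the set $X+A$ is meager. *)

theory Defs
  imports "HOL-Probability.Probability"
begin

text \<open>
  Points of the Cantor space are functions of type \<open>nat \<Rightarrow> bool\<close>, with \<open>False\<close> as 0 and \<open>True\<close>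
  as 1. Its topology is the type-class topology: the product topology over the discrete type
  \<open>bool\<close>.
\<close>

type_synonym cantor = "nat \<Rightarrow> bool"

text \<open>On \<open>bool\<close>, addition modulo 2 is exclusive or, that is, \<open>\<noteq>\<close>.\<close>

definition cantor_add :: "cantor \<Rightarrow> cantor \<Rightarrow> cantor" where
  "cantor_add x y = (\<lambda>n. x n \<noteq> y n)"

definition cantor_set_add :: "cantor set \<Rightarrow> cantor set \<Rightarrow> cantor set" where
  "cantor_set_add A B = {cantor_add a b |a b. a \<in> A \<and> b \<in> B}"

text \<open>
  The product measure itself lives on the product sigma-algebra only. Lebesgue measure is its
  completion, so subsets of null sets are measurable and null.
\<close>

definition cantor_lebesgue :: "cantor measure" where
  "cantor_lebesgue =
    completion (Pi\<^sub>M (UNIV :: nat set) (\<lambda>_. measure_pmf (bernoulli_pmf (1 / 2))))"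

definition cantor_null :: "cantor set \<Rightarrow> bool" where
  "cantor_null A \<longleftrightarrow> A \<in> null_sets cantor_lebesgue"

definition nowhere_dense :: "'a::topological_space set \<Rightarrow> bool" where
  "nowhere_dense A \<longleftrightarrow> interior (closure A) = {}"

definition meager :: "'a::topological_space set \<Rightarrow> bool" where
  "meager A \<longleftrightarrow> (\<exists>F :: nat \<Rightarrow> 'a set. (\<forall>n. nowhere_dense (F n)) \<and> A = (\<Union>n. F n))"

definition null_additive :: "cantor set \<Rightarrow> bool" where
  "null_additive X \<longleftrightarrow> (\<forall>A. cantor_null A \<longrightarrow> cantor_null (cantor_set_add X A))"

definition meager_additive :: "cantor set \<Rightarrow> bool" where
  "meager_additive X \<longleftrightarrow> (\<forall>A. meager A \<longrightarrow> meager (cantor_set_add X A))"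

end

theory Submission
  imports Defs
begin

text \<open>
  Since meager sets form a \<open>\<sigma>\<close>-ideal, it suffices to show that \<open>X + N\<close> is meager for each nowhere
  dense \<open>N\<close>. If \<open>2 ^ n\<close> points are given, then on a sufficiently long block of coordinates a single
  pattern avoids all their sums with points of \<open>N\<close>, and the length needed does not depend on the
  points (\<open>nowhere_dense_avoid_translates\<close>). So \<open>Y + N\<close> is nowhere dense as soon as, on infinitely many
  blocks, the points of \<open>Y\<close> leave fewer than \<open>2 ^ n\<close> different traces, where \<open>n\<close> is the number
  of the block (\<open>nowhere_dense_add_of_few_traces\<close>). The task is to cover \<open>X\<close> by countably many such \<open>Y\<close>.

  Null-additivity is applied to one explicit null set. After the \<open>n\<close>-th block, room is left for an
  \<open>n\<close>-row matrix \<open>M\<close> over the field with two elements and for a vector \<open>b\<close>. Let \<open>H n\<close> be the set of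
  all \<open>z\<close> for which \<open>M\<close> maps the block to \<open>b\<close>. It has measure \<open>1 / 2 ^ n\<close>, so by Borel--Cantelli
  the set \<open>A\<close> of points in infinitely many \<open>H n\<close> is null. Affine hash functions are pairwise
  independent, which here means: the translates of \<open>H n\<close> by two points with different traces on
  the \<open>n\<close>-th block are independent events (\<open>measure_hash_translate_pair\<close>).

  As \<open>X + A\<close> is null, a closed set of positive measure misses it, and after trimming every
  cylinder that meets this set does so in positive measure. Call it \<open>K\<close>. For \<open>x\<close> in \<open>X\<close> no point of
  \<open>K\<close> lies in infinitely many of the sets \<open>x + H n\<close>, so by the Baire category theorem there is a
  cylinder meeting \<open>K\<close> within which \<open>K\<close> misses \<open>x + H n\<close> for all large \<open>n\<close>
  (\<open>baire_avoid_translate\<close>). Sorting the points of \<open>X\<close> by these cylinders covers \<open>X\<close> by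
  countably many pieces \<open>Y\<close>. For each piece, one set of positive measure misses \<open>x + H n\<close> for all \<open>x\<close> in \<open>Y\<close> and all
  large \<open>n\<close>. If \<open>Y\<close> had \<open>2 ^ n\<close> traces on every late block, these would be pairwise independent
  events whose probabilities have infinite sum, and Chebyshev's inequality would make
  that set null (\<open>few_traces\<close>).
\<close>

section \<open>Cylinders and nowhere dense sets\<close>

definition cylinder :: "bool list \<Rightarrow> cantor set" where
  "cylinder s = {z. \<forall>k<length s. z k = s ! k}"

definition prefix :: "nat \<Rightarrow> cantor \<Rightarrow> bool list" where
  "prefix m z = map z [0..<m]"

lemma length_prefix [simp]: "length (prefix m z) = m"
  by (simp add: prefix_def)

lemma in_cylinder_prefix_iff: "y \<in> cylinder (prefix m z) \<longleftrightarrow> (\<forall>k<m. y k = z k)"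
  by (simp add: cylinder_def prefix_def)

lemma in_own_cylinder [simp]: "z \<in> cylinder (prefix m z)"
  by (simp add: in_cylinder_prefix_iff)

lemma prefix_eq_iff: "prefix m y = prefix m z \<longleftrightarrow> (\<forall>k<m. y k = z k)"
  by (auto simp: prefix_def)

lemma finite_range_prefix: "finite (range (prefix m))"
  by (rule finite_subset[OF _ finite_lists_length_eq[of "UNIV :: bool set" m]]) auto

lemma open_cylinder: "open (cylinder s)"
proof -
  have "open {z :: cantor. \<forall>k\<in>{..<length s}. z (id k) \<in> {s ! k}}"
    by (rule product_topology_basis') (auto intro: discrete_topology_class.open_discrete)
  then show ?thesis by (simp add: cylinder_def Ball_def)
qed

lemma open_contains_cylinder:
  fixes U :: "cantor set"
  assumes "open U" "z \<in> U"
  obtains m where "cylinder (prefix m z) \<subseteq> U"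
proof -
  have "openin (product_topology (\<lambda>_. euclidean) UNIV) U"
    using assms(1) by (simp add: open_fun_def)
  from product_topology_open_contains_basis[OF this assms(2)] obtain X where X:
    "z \<in> Pi\<^sub>E UNIV X" "finite {i. X i \<noteq> UNIV}" "Pi\<^sub>E UNIV X \<subseteq> U" by auto
  from X(2) obtain m where m: "\<forall>i\<in>{i. X i \<noteq> UNIV}. i < m"
    using finite_nat_set_iff_bounded by blast
  have "cylinder (prefix m z) \<subseteq> Pi\<^sub>E UNIV X"
  proof
    fix y assume y: "y \<in> cylinder (prefix m z)"
    have "y i \<in> X i" for i
    proof (cases "X i = UNIV")
      case False
      then have "y i = z i" using y m by (auto simp: in_cylinder_prefix_iff)
      then show ?thesis using X(1) by (auto simp: PiE_iff)
    qed auto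
    then show "y \<in> Pi\<^sub>E UNIV X" by auto
  qed
  with X(3) have "cylinder (prefix m z) \<subseteq> U" by (rule subset_trans[rotated])
  then show thesis by (rule that)
qed

lemma nowhere_dense_iff_cylinders:
  "nowhere_dense (N :: cantor set) \<longleftrightarrow>
    (\<forall>z m. \<exists>y q. (\<forall>k<m. y k = z k) \<and> m \<le> q \<and> N \<inter> cylinder (prefix q y) = {})"
proof
  assume nd: "nowhere_dense N"
  show "\<forall>z m. \<exists>y q. (\<forall>k<m. y k = z k) \<and> m \<le> q \<and> N \<inter> cylinder (prefix q y) = {}"
  proof (intro allI)
    fix z :: cantor and m
    have "\<not> cylinder (prefix m z) \<subseteq> closure N"
      using nd interior_maximal[OF _ open_cylinder] in_own_cylinder
      unfolding nowhere_dense_def by blast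
    then obtain y where y: "y \<in> cylinder (prefix m z)" "y \<in> - closure N" by auto
    then obtain q where q: "cylinder (prefix q y) \<subseteq> - closure N"
      using open_contains_cylinder[of "- closure N" y] by auto
    have "cylinder (prefix (max m q) y) \<subseteq> cylinder (prefix q y)"
      by (auto simp: in_cylinder_prefix_iff)
    then have "N \<inter> cylinder (prefix (max m q) y) = {}"
      using q closure_subset[of N] by blast
    then show "\<exists>y q. (\<forall>k<m. y k = z k) \<and> m \<le> q \<and> N \<inter> cylinder (prefix q y) = {}"
      using y(1) by (intro exI[of _ y] exI[of _ "max m q"]) (auto simp: in_cylinder_prefix_iff)
  qed
next
  assume avoid: "\<forall>z m. \<exists>y q. (\<forall>k<m. y k = z k) \<and> m \<le> q \<and> N \<inter> cylinder (prefix q y) = {}"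
  show "nowhere_dense N"
    unfolding nowhere_dense_def
  proof (rule ccontr)
    assume "interior (closure N) \<noteq> {}"
    then obtain z m where m: "cylinder (prefix m z) \<subseteq> interior (closure N)"
      using open_contains_cylinder[OF open_interior] by blast
    obtain y q where y: "\<forall>k<m. y k = z k" "m \<le> q" "N \<inter> cylinder (prefix q y) = {}"
      using avoid[rule_format, of m z] by metis
    have "closure N \<inter> cylinder (prefix q y) = {}"
      using y(3) open_Int_closure_eq_empty[OF open_cylinder] by blast
    moreover have "y \<in> closure N"
      using m y(1) interior_subset[of "closure N"] by (force simp: in_cylinder_prefix_iff)
    ultimately show False using in_own_cylinder[of y q] by blast
  qed
qed

text \<open>
  A nowhere dense set can be avoided by one pattern \<open>t\<close> on a block \<open>[p, q)\<close>, whatever happens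
  below \<open>p\<close>: there are only finitely many prefixes of length \<open>p\<close>, and the block is lengthened
  once for each of them.
\<close>

lemma nowhere_dense_avoid_pattern:
  assumes "nowhere_dense (N :: cantor set)"
  shows "\<exists>q\<ge>p. \<exists>t. \<forall>v\<in>N. \<exists>k\<in>{p..<q}. v k \<noteq> t k"
proof -
  have "\<exists>q\<ge>p. \<exists>t. \<forall>v\<in>N. prefix p v \<in> S \<longrightarrow> (\<exists>k\<in>{p..<q}. v k \<noteq> t k)"
    if "finite S" "S \<subseteq> range (prefix p)" for S
    using that
  proof (induction S)
    case (insert s S)
    then obtain q t where q: "q \<ge> p"
      and t: "\<forall>v\<in>N. prefix p v \<in> S \<longrightarrow> (\<exists>k\<in>{p..<q}. v k \<noteq> t k)" by auto
    obtain x where x: "s = prefix p x" using insert.prems by auto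
    obtain y r where y: "\<forall>k<q. y k = (if k < p then x k else t k)" "q \<le> r"
        "N \<inter> cylinder (prefix r y) = {}"
      using assms[unfolded nowhere_dense_iff_cylinders, rule_format,
          of q "\<lambda>k. if k < p then x k else t k"] by metis
    have "\<exists>k\<in>{p..<r}. v k \<noteq> y k" if v: "v \<in> N" "prefix p v \<in> insert s S" for v
    proof (cases "prefix p v \<in> S")
      case True
      then obtain k where "k \<in> {p..<q}" "v k \<noteq> t k" using t v(1) by blast
      then show ?thesis using y(1,2) by (intro bexI[of _ k]) auto
    next
      case False
      then have "\<forall>k<p. v k = y k"
        using v(2) q y(1) x by (auto simp: prefix_eq_iff)
      moreover have "\<not> (\<forall>k<r. v k = y k)"
        using v(1) y(3) by (auto simp: in_cylinder_prefix_iff)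
      ultimately show ?thesis by (metis atLeastLessThan_iff not_le)
    qed
    then show ?case using q y(2) by (intro exI[of _ r] conjI exI[of _ y]) auto
  qed auto
  from this[OF finite_range_prefix subset_refl] show ?thesis by simp
qed

text \<open>
  Concatenating \<open>h\<close> avoiding blocks, the \<open>i\<close>-th filled with \<open>u i\<close> plus the avoiding pattern, gives
  one pattern \<open>w\<close> that avoids \<open>h\<close> translates of \<open>N\<close> at once. The end \<open>q\<close> of the block depends on
  \<open>p\<close> and \<open>h\<close> but not on the points \<open>u i\<close>; this uniformity lets the block be fixed before
  any information about the translating points is available.
\<close>

lemma nowhere_dense_avoid_translates:
  fixes h :: nat
  assumes "nowhere_dense (N :: cantor set)"
  shows "\<exists>q\<ge>p. \<forall>u. \<exists>w. \<forall>i<h. \<forall>v\<in>N. \<exists>k\<in>{p..<q}. w k \<noteq> cantor_add (u i) v k"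
proof (induction h)
  case (Suc h)
  then obtain q where q: "q \<ge> p"
    and w: "\<And>u. \<exists>w. \<forall>i<h. \<forall>v\<in>N. \<exists>k\<in>{p..<q}. w k \<noteq> cantor_add (u i) v k" by blast
  obtain r t where r: "r \<ge> q" and t: "\<forall>v\<in>N. \<exists>k\<in>{q..<r}. v k \<noteq> t k"
    using nowhere_dense_avoid_pattern[OF assms, of q] by metis
  have "\<exists>w. \<forall>i<Suc h. \<forall>v\<in>N. \<exists>k\<in>{p..<r}. w k \<noteq> cantor_add (u i) v k" for u :: "nat \<Rightarrow> cantor"
  proof -
    obtain w where w: "\<forall>i<h. \<forall>v\<in>N. \<exists>k\<in>{p..<q}. w k \<noteq> cantor_add (u i) v k"
      using w[of u] by metis
    \<comment> \<open>The first \<open>h\<close> translates are avoided below \<open>q\<close>, the last one on \<open>[q, r)\<close>.\<close>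
    define w' where "w' = (\<lambda>k. if k < q then w k else cantor_add (u h) t k)"
    have "\<exists>k\<in>{p..<r}. w' k \<noteq> cantor_add (u i) v k" if i: "i < Suc h" and v: "v \<in> N" for i v
    proof (cases "i < h")
      case True
      then obtain k where "k \<in> {p..<q}" "w k \<noteq> cantor_add (u i) v k"
        using w v by metis
      then show ?thesis using r by (intro bexI[of _ k]) (auto simp: w'_def)
    next
      case False
      obtain k where "k \<in> {q..<r}" "v k \<noteq> t k" using t v by metis
      moreover have "i = h" using False i by simp
      ultimately show ?thesis using q by (intro bexI[of _ k]) (auto simp: w'_def cantor_add_def)
    qed
    then show ?thesis by (intro exI[of _ w']) simp
  qed
  then show ?case using q r by (intro exI[of _ r]) simp
qed auto

lemma meager_countable_Union:
  fixes B :: "'i::countable \<Rightarrow> 'a::topological_space set"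
  assumes "\<And>i. meager (B i)"
  shows "meager (\<Union>i. B i)"
proof -
  obtain F where F: "\<And>i n. nowhere_dense (F i n)" "\<And>i. B i = (\<Union>n :: nat. F i n)"
    using assms unfolding meager_def by metis
  define G where "G j = (case from_nat j of (i, n) \<Rightarrow> F i n)" for j :: nat
  have "\<forall>j. nowhere_dense (G j)" by (simp add: G_def F(1) split: prod.split)
  moreover have "(\<Union>i. B i) = (\<Union>j. G j)"
  proof -
    have "F i n = G (to_nat (i, n))" for i n by (simp add: G_def)
    moreover have "\<exists>i n. G j = F i n" for j by (auto simp: G_def split: prod.split)
    ultimately show ?thesis by (auto simp: F(2)) blast+
  qed
  ultimately show ?thesis unfolding meager_def by blast
qed

lemma nowhere_dense_imp_meager: "nowhere_dense A \<Longrightarrow> meager A"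
  unfolding meager_def by (rule exI[of _ "\<lambda>_. A"]) auto

section \<open>The coin-tossing measure and coordinate flips\<close>

text \<open>
  The product measure without completion. Almost every set measured below depends on finitely
  many coordinates, so it is measurable already here; the completion enters only through null sets.
\<close>

definition coin :: "cantor measure" where
  "coin = Pi\<^sub>M (UNIV :: nat set) (\<lambda>_. measure_pmf (bernoulli_pmf (1 / 2)))"

lemma space_coin [simp]: "space coin = UNIV"
  by (simp add: coin_def space_PiM)

interpretation coin: product_prob_space "\<lambda>_. measure_pmf (bernoulli_pmf (1 / 2))" "UNIV :: nat set"
  rewrites "Pi\<^sub>M (UNIV :: nat set) (\<lambda>_. measure_pmf (bernoulli_pmf (1 / 2))) = coin"
proof -
  interpret prob_space "measure_pmf (bernoulli_pmf (1 / 2))" by (rule prob_space_measure_pmf)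
  show "product_prob_space (\<lambda>_ :: nat. measure_pmf (bernoulli_pmf (1 / 2)))" by unfold_locales
qed (simp add: coin_def)

lemma measurable_coordinate: "(\<lambda>z. z k) \<in> coin \<rightarrow>\<^sub>M count_space UNIV"
proof -
  have "(\<lambda>z. z k) \<in> coin \<rightarrow>\<^sub>M measure_pmf (bernoulli_pmf (1 / 2))"
    unfolding coin_def by (rule measurable_component_singleton) simp
  then show ?thesis by (simp cong: measurable_cong_sets)
qed

lemma cylinder_sets [measurable]: "cylinder s \<in> sets coin"
proof -
  note measurable_coordinate [measurable]
  have "Measurable.pred coin (\<lambda>z. \<forall>k<length s. z k = s ! k)" by measurable
  then show ?thesis by (simp add: cylinder_def pred_def)
qed

text \<open>
  All sets of this kind, those determined by the first \<open>m\<close> coordinates, are finite unions of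
  cylinders.
\<close>

lemma clopen_sets:
  assumes "\<And>y z. (\<And>k. k < m \<Longrightarrow> y k = z k) \<Longrightarrow> Q y = Q z"
  shows "{z. Q z} \<in> sets coin"
proof -
  have eq: "{z. Q z} = (\<Union>s\<in>prefix m ` {z. Q z}. cylinder s)"
  proof (intro subset_antisym subsetI)
    fix y assume "y \<in> (\<Union>s\<in>prefix m ` {z. Q z}. cylinder s)"
    then obtain z where "Q z" "\<forall>k<m. y k = z k" by (auto simp: in_cylinder_prefix_iff)
    then show "y \<in> {z. Q z}" using assms[of y z] by simp
  qed auto
  have "finite (prefix m ` {z. Q z})"
    by (rule finite_subset[OF _ finite_range_prefix]) auto
  then show ?thesis by (subst eq) (rule sets.finite_UN, simp_all add: cylinder_sets)
qed

text \<open>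
  Flipping one coordinate preserves the measure, and this symmetry replaces the independence of
  coordinates in all computations below.
\<close>

definition flip :: "nat \<Rightarrow> cantor \<Rightarrow> cantor" where
  "flip c z = z(c := \<not> z c)"

lemma flip_flip [simp]: "flip c (flip c z) = z"
  by (auto simp: flip_def)

lemma measurable_flip: "flip c \<in> coin \<rightarrow>\<^sub>M coin"
proof -
  have "(\<lambda>z. flip c z k) \<in> coin \<rightarrow>\<^sub>M measure_pmf (bernoulli_pmf (1 / 2))" for k
    using measurable_compose[OF measurable_coordinate[of k], of "\<lambda>b. if k = c then \<not> b else b" "count_space UNIV"]
    by (simp add: flip_def cong: measurable_cong_sets if_cong)
  then show ?thesis
    unfolding coin_def by (intro measurable_PiM_single') (auto simp: space_PiM coin_def[symmetric])
qed

lemma distr_flip: "distr coin coin (flip c) = coin"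
proof -
  let ?P = "bernoulli_pmf (1 / 2)"
  let ?emb = "\<lambda>J F. prod_emb (UNIV :: nat set) (\<lambda>_. measure_pmf ?P) J (Pi\<^sub>E J F)"
  have emb_eq: "?emb J F = {z. \<forall>j\<in>J. z j \<in> F j}" for J F
    by (auto simp: prod_emb_def PiE_iff)
  have neg: "emeasure (measure_pmf ?P) (Not -` B) = emeasure (measure_pmf ?P) B" for B
  proof -
    have "map_pmf Not ?P = ?P"
    proof (rule pmf_eqI)
      fix b
      have "pmf (map_pmf Not ?P) (Not (\<not> b)) = pmf ?P (\<not> b)"
        by (rule pmf_map_inj') (auto simp: inj_def)
      then show "pmf (map_pmf Not ?P) b = pmf ?P b" by (cases b) simp_all
    qed
    then show ?thesis using emeasure_map_pmf[of Not ?P B] by simp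
  qed
  show ?thesis
  proof (rule coin.PiM_eq)
    fix J :: "nat set" and F :: "nat \<Rightarrow> bool set"
    assume J: "finite J"
    have S: "{z. \<forall>j\<in>J. z j \<in> F j} \<in> sets coin" for F
      using sets_PiM_I[of J UNIV F "\<lambda>_. measure_pmf ?P"] J
      unfolding emb_eq coin_def by simp
    let ?G = "\<lambda>j. if j = c then Not -` F j else F j"
    have "emeasure (distr coin coin (flip c)) (?emb J F) = emeasure coin (?emb J ?G)"
    proof (subst emeasure_distr[OF measurable_flip])
      show "?emb J F \<in> sets coin" unfolding emb_eq by (rule S)
      have "flip c -` ?emb J F \<inter> space coin = ?emb J ?G"
        unfolding emb_eq by (auto simp: flip_def split: if_splits)
      then show "emeasure coin (flip c -` ?emb J F \<inter> space coin) = emeasure coin (?emb J ?G)"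
        by simp
    qed
    also have "\<dots> = (\<Prod>j\<in>J. emeasure (measure_pmf ?P) (?G j))"
      using coin.emeasure_PiM_emb[of J ?G] J by simp
    also have "\<dots> = (\<Prod>j\<in>J. emeasure (measure_pmf ?P) (F j))"
      by (rule prod.cong) (auto simp: neg)
    finally show "emeasure (distr coin coin (flip c)) (?emb J F) = (\<Prod>j\<in>J. emeasure (measure_pmf ?P) (F j))" .
  qed simp
qed

lemma measure_flip:
  assumes "A \<in> sets coin"
  shows "measure coin {z. flip c z \<in> A} = measure coin A"
proof -
  have "measure coin A = measure (distr coin coin (flip c)) A" by (simp only: distr_flip)
  also have "\<dots> = measure coin (flip c -` A \<inter> space coin)"
    by (rule measure_distr[OF measurable_flip assms])
  also have "flip c -` A \<inter> space coin = {z. flip c z \<in> A}" by auto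
  finally show ?thesis by (rule sym)
qed

text \<open>
  The flip is a measure-preserving bijection between the part of \<open>B\<close> where \<open>R\<close> holds and the part
  where it fails.
\<close>

lemma measure_half_of_toggled:
  assumes B: "B \<in> sets coin" "\<And>z. flip c z \<in> B \<longleftrightarrow> z \<in> B"
    and R: "{z. R z} \<in> sets coin" "\<And>z. R (flip c z) \<longleftrightarrow> \<not> R z"
  shows "measure coin (B \<inter> {z. R z}) = measure coin B / 2"
proof -
  let ?C = "B \<inter> {z. R z}"
  have C: "?C \<in> sets coin" using B(1) R(1) by (rule sets.Int)
  have "measure coin ?C = measure coin {z. flip c z \<in> ?C}"
    by (rule measure_flip[OF C, symmetric])
  also have "{z. flip c z \<in> ?C} = B - ?C"
    using B(2) R(2) by auto
  also have "measure coin (B - ?C) = measure coin B - measure coin ?C"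
    using B(1) C by (intro coin.finite_measure_Diff) auto
  finally show ?thesis by simp
qed

text \<open>
  Conditions with private switches behave like independent fair coins: if each \<open>R i\<close> has a
  coordinate \<open>c i\<close> whose flip toggles it and disturbs neither \<open>B\<close> nor the other conditions, then every
  condition halves the measure.
\<close>

lemma measure_of_independent_toggles:
  assumes "finite I" "B \<in> sets coin"
    and "\<And>i z. i \<in> I \<Longrightarrow> flip (c i) z \<in> B \<longleftrightarrow> z \<in> B"
    and "\<And>i. i \<in> I \<Longrightarrow> {z. R i z} \<in> sets coin"
    and "\<And>i z. i \<in> I \<Longrightarrow> R i (flip (c i) z) \<longleftrightarrow> \<not> R i z"
    and "\<And>i j z. i \<in> I \<Longrightarrow> j \<in> I \<Longrightarrow> i \<noteq> j \<Longrightarrow> R i (flip (c j) z) \<longleftrightarrow> R i z"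
  shows "measure coin (B \<inter> {z. \<forall>i\<in>I. R i z}) = measure coin B / 2 ^ card I"
  using assms
proof (induction I)
  case (insert i I)
  let ?B = "B \<inter> {z. \<forall>j\<in>I. R j z}"
  have "{z \<in> space coin. \<forall>j\<in>I. R j z} \<in> sets coin"
    using insert.hyps insert.prems(3) by (intro sets.sets_Collect_finite_All) auto
  then have B: "?B \<in> sets coin" using insert.prems(1) by (intro sets.Int) auto
  have "B \<inter> {z. \<forall>j\<in>insert i I. R j z} = ?B \<inter> {z. R i z}" by auto
  also have "measure coin \<dots> = measure coin ?B / 2"
  proof (rule measure_half_of_toggled[OF B, where c = "c i"])
    fix z
    have "R j (flip (c i) z) \<longleftrightarrow> R j z" if "j \<in> I" for j
      using insert.prems(5)[of j i z] insert.hyps that by auto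
    then show "flip (c i) z \<in> ?B \<longleftrightarrow> z \<in> ?B" using insert.prems(2)[of i z] by auto
  qed (use insert.prems in auto)
  also have "measure coin ?B = measure coin B / 2 ^ card I"
    using insert.prems by (intro insert.IH) auto
  finally show ?case using insert.hyps by simp
qed simp

section \<open>Pairwise independent events\<close>

text \<open>
  Let \<open>f\<close> count the events that occur and let \<open>s\<close> be its mean. By pairwise independence the variance
  of \<open>f\<close> is at most \<open>s\<close>. On \<open>K\<close> the count is 0, so it deviates from its mean by \<open>s\<close> there, and
  Chebyshev's inequality bounds the measure of \<open>K\<close>.
\<close>

lemma (in prob_space) chebyshev_pairwise_independent:
  assumes "finite J" and E: "\<And>j. j \<in> J \<Longrightarrow> E j \<in> events" and "K \<in> events"
    and indep: "\<And>i j. i \<in> J \<Longrightarrow> j \<in> J \<Longrightarrow> i \<noteq> j \<Longrightarrow> prob (E i \<inter> E j) = prob (E i) * prob (E j)"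
    and disj: "\<And>j. j \<in> J \<Longrightarrow> K \<inter> E j = {}"
  shows "prob K * (\<Sum>j\<in>J. prob (E j))\<^sup>2 \<le> (\<Sum>j\<in>J. prob (E j))"
proof -
  define s where "s = (\<Sum>j\<in>J. prob (E j))"
  define f where "f x = (\<Sum>j\<in>J. indicator (E j) x :: real)" for x
  have int_E: "integrable M (indicator (E j) :: 'a \<Rightarrow> real)" if "j \<in> J" for j
    using E[OF that] by (intro integrable_real_indicator) (auto simp: emeasure_eq_measure)
  have int_EE: "integrable M (\<lambda>x. indicator (E i \<inter> E j) x :: real)" if "i \<in> J" "j \<in> J" for i j
    using E that by (intro integrable_real_indicator) (auto simp: emeasure_eq_measure)
  have int_f: "integrable M f" unfolding f_def using int_E by (intro Bochner_Integration.integrable_sum)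
  have f2: "(f x)\<^sup>2 = (\<Sum>i\<in>J. \<Sum>j\<in>J. indicator (E i \<inter> E j) x)" for x
    unfolding f_def power2_eq_square sum_product by (simp add: indicator_inter_arith)
  have int_f2: "integrable M (\<lambda>x. (f x)\<^sup>2)"
    unfolding f2 using int_EE by (intro Bochner_Integration.integrable_sum)
  have Ef: "expectation f = s"
    unfolding f_def s_def using int_E E
    by (subst Bochner_Integration.integral_sum) (auto intro!: sum.cong simp: Int_absorb2 sets.sets_into_space)
  have "expectation (\<lambda>x. (f x)\<^sup>2) = (\<Sum>i\<in>J. \<Sum>j\<in>J. prob (E i \<inter> E j))"
    unfolding f2 using int_EE E
    by (subst Bochner_Integration.integral_sum, force)
       (intro sum.cong refl, subst Bochner_Integration.integral_sum,
        auto intro!: sum.cong arg_cong[where f = prob] dest: sets.sets_into_space)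
  also have "\<dots> \<le> (\<Sum>i\<in>J. \<Sum>j\<in>J. prob (E i) * prob (E j) + (if i = j then prob (E i) else 0))"
    by (intro sum_mono) (auto simp: indep)
  also have "\<dots> = s\<^sup>2 + s"
    using \<open>finite J\<close> by (simp add: sum.distrib s_def power2_eq_square sum_product)
  finally have Ef2: "expectation (\<lambda>x. (f x)\<^sup>2) \<le> s\<^sup>2 + s" .
  have sq: "(f x - s)\<^sup>2 = (f x)\<^sup>2 - 2 * s * f x + s\<^sup>2" for x
    by (simp add: power2_eq_square algebra_simps)
  have int_sq: "integrable M (\<lambda>x. (f x - s)\<^sup>2)"
    unfolding sq using int_f int_f2 by auto
  have "prob K * s\<^sup>2 = expectation (\<lambda>x. s\<^sup>2 * indicator K x)"
    using \<open>K \<in> events\<close> by (simp add: Int_absorb2 sets.sets_into_space)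
  also have "\<dots> \<le> expectation (\<lambda>x. (f x - s)\<^sup>2)"
  proof (rule integral_mono[OF _ int_sq])
    show "integrable M (\<lambda>x. s\<^sup>2 * indicator K x)"
      using \<open>K \<in> events\<close> by (intro integrable_mult_right integrable_real_indicator) (auto simp: emeasure_eq_measure)
    fix x
    have "f x = 0" if "x \<in> K"
      unfolding f_def using disj that by (intro sum.neutral) (auto simp: indicator_def)
    then show "s\<^sup>2 * indicator K x \<le> (f x - s)\<^sup>2" by (auto simp: indicator_def)
  qed
  also have "\<dots> = expectation (\<lambda>x. (f x)\<^sup>2) - 2 * s * s + s\<^sup>2"
    unfolding sq using int_f int_f2 by (simp add: Ef prob_space)
  also have "\<dots> \<le> s" using Ef2 by (simp add: power2_eq_square)
  finally show ?thesis by (simp add: s_def)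
qed

section \<open>Hash sets and the independence of their translates\<close>

text \<open>
  The inner product over the field with two elements of the two length-\<open>l\<close> blocks of \<open>z\<close> that
  start at \<open>p\<close> and at \<open>q\<close>.
\<close>

definition inner_parity :: "nat \<Rightarrow> nat \<Rightarrow> nat \<Rightarrow> cantor \<Rightarrow> bool" where
  "inner_parity l p q z = odd (\<Sum>e<l. of_bool (z (p + e) \<and> z (q + e)) :: nat)"

lemma inner_parity_cong:
  assumes "\<And>e. e < l \<Longrightarrow> y (p + e) = z (p + e) \<and> y (q + e) = z (q + e)"
  shows "inner_parity l p q y = inner_parity l p q z"
  unfolding inner_parity_def using assms by (intro arg_cong[where f = odd] sum.cong) auto

lemma inner_parity_flip:
  assumes "p + l \<le> q" "e < l"
  shows "inner_parity l p q (flip (q + e) z) \<longleftrightarrow> inner_parity l p q z \<noteq> z (p + e)"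
proof -
  let ?t = "\<lambda>z e. of_bool (z (p + e) \<and> z (q + e)) :: nat"
  have split: "(\<Sum>e<l. ?t y e) = ?t y e + (\<Sum>e'\<in>{..<l} - {e}. ?t y e')" for y
    using assms(2) by (intro sum.remove) auto
  have "(\<Sum>e'\<in>{..<l} - {e}. ?t (flip (q + e) z) e') = (\<Sum>e'\<in>{..<l} - {e}. ?t z e')"
    using assms by (intro sum.cong) (auto simp: flip_def)
  moreover have "?t (flip (q + e) z) e = of_bool (z (p + e) \<and> \<not> z (q + e))"
    using assms by (auto simp: flip_def)
  ultimately show ?thesis
    unfolding inner_parity_def split[of z] split[of "flip (q + e) z"] by auto
qed

text \<open>
  From position \<open>p\<close> on, \<open>z\<close> is read as a vector \<open>a\<close> of length \<open>l\<close>, then a \<open>d\<close> by \<open>l\<close> matrix \<open>M\<close> written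
  row by row, then a vector \<open>b\<close> of length \<open>d\<close>. The \<open>i\<close>-th hash bit says that \<open>M a\<close> and \<open>b\<close> agree in
  coordinate \<open>i\<close>, so \<open>hash_set p l d\<close> is the set where \<open>M a = b\<close>. As \<open>M\<close> and \<open>b\<close> are themselves part of
  \<open>z\<close>, this is the usual universal family of affine hash functions, coded into a single set.
\<close>

definition hash_bit :: "nat \<Rightarrow> nat \<Rightarrow> nat \<Rightarrow> nat \<Rightarrow> cantor \<Rightarrow> bool" where
  "hash_bit p l d i z \<longleftrightarrow> z (p + l * Suc d + i) = inner_parity l p (p + l * Suc i) z"

definition hash_set :: "nat \<Rightarrow> nat \<Rightarrow> nat \<Rightarrow> cantor set" where
  "hash_set p l d = {z. \<forall>i<d. hash_bit p l d i z}"

lemma row_less: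
  assumes "i < d" "e < l"
  shows "l * Suc i + e < l * Suc (d :: nat)"
proof -
  have "l * Suc (Suc i) \<le> l * Suc d" using assms(1) by (intro mult_le_mono2) simp
  then show ?thesis using assms(2) by simp
qed

lemma rows_disjoint:
  assumes "i \<noteq> j" "e < l" "e' < (l :: nat)"
  shows "l * Suc i + e \<noteq> l * Suc j + e'"
proof (cases "i < j")
  case True
  then show ?thesis using row_less[of i j e l] assms by linarith
next
  case False
  then show ?thesis using row_less[of j i e' l] assms by linarith
qed

lemma hash_bit_cong:
  assumes "i < d" "\<And>k. k < p + l * Suc d + d \<Longrightarrow> y k = z k"
  shows "hash_bit p l d i y = hash_bit p l d i z"
proof -
  have "inner_parity l p (p + l * Suc i) y = inner_parity l p (p + l * Suc i) z"
  proof (rule inner_parity_cong)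
    fix e assume e: "e < l"
    have "p + l * Suc i + e < p + l * Suc d + d" using row_less[OF assms(1) e] by simp
    moreover have "p + e < p + l * Suc d + d" using e by simp
    ultimately show "y (p + e) = z (p + e) \<and> y (p + l * Suc i + e) = z (p + l * Suc i + e)"
      using assms(2) by blast
  qed
  moreover have "y (p + l * Suc d + i) = z (p + l * Suc d + i)" using assms by simp
  ultimately show ?thesis by (simp only: hash_bit_def)
qed

lemma hash_set_cong:
  assumes "\<And>k. k < p + l * Suc d + d \<Longrightarrow> y k = z k"
  shows "y \<in> hash_set p l d \<longleftrightarrow> z \<in> hash_set p l d"
  using hash_bit_cong[of _ d p l y z] assms by (simp add: hash_set_def)

lemma hash_bit_flip_check:
  assumes "i < d" "j < d"
  shows "hash_bit p l d i (flip (p + l * Suc d + j) z) \<longleftrightarrow> (hash_bit p l d i z \<noteq> (i = j))"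
proof -
  have "inner_parity l p (p + l * Suc i) (flip (p + l * Suc d + j) z) = inner_parity l p (p + l * Suc i) z"
    using row_less[OF assms(1)] by (intro inner_parity_cong) (fastforce simp: flip_def)
  then show ?thesis unfolding hash_bit_def by (auto simp: flip_def)
qed

lemma hash_bit_flip_row:
  assumes "i < d" "j < d" "e < l"
  shows "hash_bit p l d i (flip (p + l * Suc j + e) z) \<longleftrightarrow>
    (hash_bit p l d i z \<noteq> (i = j \<and> z (p + e)))"
proof -
  have "p + l * Suc d + i \<noteq> p + l * Suc j + e" using row_less[OF assms(2,3)] by simp
  then have same: "flip (p + l * Suc j + e) z (p + l * Suc d + i) = z (p + l * Suc d + i)"
    unfolding flip_def by (rule fun_upd_other)
  show ?thesis
  proof (cases "i = j")
    case True
    have "inner_parity l p (p + l * Suc i) (flip (p + l * Suc i + e) z)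
        \<longleftrightarrow> inner_parity l p (p + l * Suc i) z \<noteq> z (p + e)"
      using assms by (intro inner_parity_flip) auto
    then show ?thesis using same True unfolding hash_bit_def by auto
  next
    case False
    have "inner_parity l p (p + l * Suc i) (flip (p + l * Suc j + e) z) = inner_parity l p (p + l * Suc i) z"
    proof (rule inner_parity_cong)
      fix e' assume e': "e' < l"
      have "p + l * Suc i + e' \<noteq> p + l * Suc j + e" using rows_disjoint[OF False e' assms(3)] by simp
      moreover have "p + e' \<noteq> p + l * Suc j + e" using e' by simp
      ultimately show "flip (p + l * Suc j + e) z (p + e') = z (p + e') \<and>
        flip (p + l * Suc j + e) z (p + l * Suc i + e') = z (p + l * Suc i + e')"
        unfolding flip_def by (intro conjI fun_upd_other)
    qed
    then show ?thesis using same False unfolding hash_bit_def by simp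
  qed
qed

lemma cantor_add_flip: "cantor_add u (flip c z) = flip c (cantor_add u z)"
  by (rule ext) (simp add: cantor_add_def flip_def)

lemma hash_bit_translate_sets:
  assumes "i < d"
  shows "{z. hash_bit p l d i (cantor_add u z)} \<in> sets coin"
  by (rule clopen_sets[where m = "p + l * Suc d + d"], rule hash_bit_cong[OF assms])
     (simp add: cantor_add_def)

text \<open>
  Translation by \<open>u\<close> is an involution, so this is the translate of \<open>hash_set p l d\<close> by \<open>u\<close>.
\<close>

definition hash_translate :: "nat \<Rightarrow> nat \<Rightarrow> nat \<Rightarrow> cantor \<Rightarrow> cantor set" where
  "hash_translate p l d u = {z. cantor_add u z \<in> hash_set p l d}"

lemma hash_translate_sets: "hash_translate p l d u \<in> sets coin"
  unfolding hash_translate_def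
  by (rule clopen_sets[where m = "p + l * Suc d + d"], rule hash_set_cong)
     (simp add: cantor_add_def)

text \<open>
  The entries of the vector \<open>b\<close> are switches for the \<open>d\<close> hash bits, and \<open>B\<close> does not see them.
\<close>

lemma measure_inter_hash_translate:
  assumes "B \<in> sets coin" "\<And>c z. p + l * Suc d \<le> c \<Longrightarrow> flip c z \<in> B \<longleftrightarrow> z \<in> B"
  shows "measure coin (B \<inter> hash_translate p l d u) = measure coin B / 2 ^ d"
proof -
  have "measure coin (B \<inter> {z. \<forall>i\<in>{..<d}. hash_bit p l d i (cantor_add u z)})
      = measure coin B / 2 ^ card {..<d}"
    using assms
    by (intro measure_of_independent_toggles[where c = "\<lambda>i. p + l * Suc d + i"])
       (auto simp: hash_bit_translate_sets cantor_add_flip hash_bit_flip_check simp del: mult_Suc_right)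
  then show ?thesis by (simp add: hash_translate_def hash_set_def Ball_def)
qed

lemma measure_hash_translate: "measure coin (hash_translate p l d u) = 1 / 2 ^ d"
proof -
  have "UNIV \<in> sets coin" using sets.top[of coin] by simp
  from measure_inter_hash_translate[OF this] show ?thesis
    using coin.P.prob_space by simp
qed

text \<open>
  Translates by points that differ somewhere in the vector block are independent. Write their
  intersection as \<open>D\<close>, where the two translated hashes have equal bits, together with one of them.
  Translating moves \<open>a\<close> to \<open>a + u\<close> and to \<open>a + v\<close>. These differ in some entry \<open>e\<close>, so flipping entry
  \<open>e\<close> of row \<open>i\<close> changes exactly one of the two \<open>i\<close>-th bits: these entries are switches for
  \<open>D\<close>. Flipping an entry of \<open>b\<close> changes both bits, so \<open>D\<close> does not see it, and the entries of \<open>b\<close>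
  are switches for the rest.
\<close>

lemma measure_hash_translate_pair:
  assumes "e < l" "u (p + e) \<noteq> v (p + e)"
  shows "measure coin (hash_translate p l d u \<inter> hash_translate p l d v) = 1 / 2 ^ d * (1 / 2 ^ d)"
proof -
  let ?R = "\<lambda>u i z. hash_bit p l d i (cantor_add u z)"
  let ?D = "{z. \<forall>i\<in>{..<d}. ?R u i z = ?R v i z}"
  have D_sets: "{z. ?R u i z = ?R v i z} \<in> sets coin" if "i < d" for i
    by (rule clopen_sets[where m = "p + l * Suc d + d"],
        intro arg_cong2[where f = "(=)"] hash_bit_cong[OF that])
       (simp_all add: cantor_add_def)
  have D: "?D \<in> sets coin"
    by (rule clopen_sets[where m = "p + l * Suc d + d"],
        intro ball_cong refl arg_cong2[where f = "(=)"] hash_bit_cong)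
       (simp_all add: cantor_add_def)
  have "UNIV \<in> sets coin" using sets.top[of coin] by simp
  then have "measure coin (UNIV \<inter> ?D) = measure coin UNIV / 2 ^ card {..<d}"
    using assms
    by (intro measure_of_independent_toggles[where c = "\<lambda>i. p + l * Suc i + e"] D_sets)
       (auto simp: cantor_add_flip hash_bit_flip_row simp del: mult_Suc_right,
        auto simp: cantor_add_def)
  then have mD: "measure coin ?D = 1 / 2 ^ d" using coin.P.prob_space by simp
  have eq: "hash_translate p l d u \<inter> hash_translate p l d v = ?D \<inter> {z. \<forall>i\<in>{..<d}. ?R u i z}"
    by (auto simp: hash_translate_def hash_set_def)
  have half: "measure coin (?D \<inter> {z. \<forall>i\<in>{..<d}. ?R u i z}) = measure coin ?D / 2 ^ card {..<d}"
  proof (rule measure_of_independent_toggles[OF _ D, where c = "\<lambda>i. p + l * Suc d + i"])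
    have bit: "hash_bit p l d i (cantor_add u (flip (p + l * Suc d + j) z))
        \<longleftrightarrow> (hash_bit p l d i (cantor_add u z) \<noteq> (i = j))" if "i < d" "j < d" for i j u z
      using hash_bit_flip_check[OF that] by (simp only: cantor_add_flip)
    show "flip (p + l * Suc d + j) z \<in> ?D \<longleftrightarrow> z \<in> ?D" if "j \<in> {..<d}" for j z
    proof -
      have "(?R u i (flip (p + l * Suc d + j) z) = ?R v i (flip (p + l * Suc d + j) z))
          \<longleftrightarrow> (?R u i z = ?R v i z)" if "i < d" for i
        using bit[OF that, of j] \<open>j \<in> {..<d}\<close> by auto
      then show ?thesis by (simp only: mem_Collect_eq lessThan_iff Ball_def) metis
    qed
    show "{z. ?R u i z} \<in> sets coin" if "i \<in> {..<d}" for i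
      using that hash_bit_translate_sets by simp
    show "?R u i (flip (p + l * Suc d + i) z) \<longleftrightarrow> \<not> ?R u i z" if "i \<in> {..<d}" for i z
      using bit that by simp
    show "?R u i (flip (p + l * Suc d + j) z) \<longleftrightarrow> ?R u i z"
      if "i \<in> {..<d}" "j \<in> {..<d}" "i \<noteq> j" for i j z
      using bit that by simp
  qed simp
  have "measure coin (hash_translate p l d u \<inter> hash_translate p l d v) = 1 / 2 ^ d / 2 ^ d"
    unfolding eq half mD card_lessThan ..
  then show ?thesis by simp
qed

section \<open>A closed set that misses a null set\<close>

text \<open>
  Outer regularity holds for finite Borel measures on Polish spaces. The Cantor space is
  embedded into the Polish space of real sequences, with a Borel left inverse \<open>g\<close>, to transfer it.
\<close>

lemma null_set_open_cover:
  assumes "B \<in> null_sets coin"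
  shows "\<exists>U. open U \<and> U \<in> sets coin \<and> B \<subseteq> U \<and> emeasure coin U < 1"
proof -
  define f :: "cantor \<Rightarrow> nat \<Rightarrow> real" where "f z = (\<lambda>n. of_bool (z n))" for z
  define g :: "(nat \<Rightarrow> real) \<Rightarrow> cantor" where "g y = (\<lambda>n. y n > 1 / 2)" for y
  have g_f: "g (f z) = z" for z by (rule ext) (simp add: f_def g_def)
  have f_meas: "f \<in> coin \<rightarrow>\<^sub>M borel"
  proof (rule measurable_coordinatewise_then_product)
    fix n show "(\<lambda>z. f z n) \<in> borel_measurable coin"
      unfolding f_def by (rule measurable_compose[OF measurable_coordinate[of n]]) simp
  qed
  have f_cont: "continuous_on UNIV f"
  proof (rule continuous_on_coordinatewise_then_product)
    fix n
    have "continuous_on (UNIV :: bool set) (of_bool :: bool \<Rightarrow> real)"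
      by (simp add: continuous_on_open_vimage open_discrete)
    from continuous_on_compose2[OF this continuous_on_product_coordinates[of n]]
    show "continuous_on UNIV (\<lambda>z. f z n)" unfolding f_def by simp
  qed
  have g_meas: "g \<in> borel \<rightarrow>\<^sub>M coin"
  proof -
    have "(\<lambda>y :: nat \<Rightarrow> real. y n > 1 / 2) \<in> borel \<rightarrow>\<^sub>M count_space UNIV" for n
      by measurable
    then have "(\<lambda>y. g y n) \<in> borel \<rightarrow>\<^sub>M measure_pmf (bernoulli_pmf (1 / 2))" for n
      by (simp add: g_def cong: measurable_cong_sets)
    then show ?thesis
      unfolding coin_def by (intro measurable_PiM_single') auto
  qed
  have B: "B \<in> sets coin" using assms by auto
  have B': "g -` B \<in> sets borel"
    using measurable_sets[OF g_meas B] by simp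
  define D where "D = distr coin borel f"
  have "emeasure D (g -` B) = emeasure coin (f -` (g -` B) \<inter> space coin)"
    unfolding D_def by (rule emeasure_distr[OF f_meas B'])
  also have "f -` (g -` B) \<inter> space coin = B" by (auto simp: g_f)
  also have "emeasure coin B = 0" using assms by auto
  finally have "emeasure D (g -` B) = 0" .
  moreover have "emeasure D (g -` B) = (INF U \<in> {U. g -` B \<subseteq> U \<and> open U}. emeasure D U)"
  proof (rule outer_regular)
    have "prob_space D"
      unfolding D_def by (rule prob_space.prob_space_distr[OF coin.P.prob_space_axioms f_meas])
    then show "emeasure D (space D) \<noteq> \<infinity>" by (simp add: prob_space.emeasure_space_1)
  qed (simp_all add: D_def B')
  ultimately have "(INF U \<in> {U. g -` B \<subseteq> U \<and> open U}. emeasure D U) < 1" by simp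
  then obtain U where U: "g -` B \<subseteq> U" "open U" "emeasure D U < 1"
    by (auto simp: INF_less_iff)
  have "emeasure D U = emeasure coin (f -` U)"
    unfolding D_def using emeasure_distr[OF f_meas, of U] U(2) by simp
  moreover have "f -` U \<in> sets coin" using measurable_sets[OF f_meas, of U] U(2) by simp
  moreover have "open (f -` U)" using U(2) f_cont by (simp add: continuous_on_open_vimage)
  moreover have "B \<subseteq> f -` U" using U(1) by (auto simp: g_f subset_iff)
  ultimately show ?thesis using U(3) by (intro exI[of _ "f -` U"]) simp
qed

text \<open>
  Take the complement of an open cover of \<open>B\<close> of measure below 1 and remove from it the countably
  many cylinders that it meets in a null set only. The last property says that the closure of \<open>K\<close>
  misses \<open>B\<close>; it survives the removal, because shrinking a set can only shrink its closure.
\<close>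

lemma self_supporting_set_avoiding_null_set:
  assumes "B \<in> null_sets coin"
  obtains K where "K \<in> sets coin" "K \<noteq> {}"
    "\<And>s. K \<inter> cylinder s \<noteq> {} \<Longrightarrow> measure coin (K \<inter> cylinder s) > 0"
    "\<And>z. (\<And>m. K \<inter> cylinder (prefix m z) \<noteq> {}) \<Longrightarrow> z \<notin> B"
proof -
  obtain U where U: "open U" "U \<in> sets coin" "B \<subseteq> U" "emeasure coin U < 1"
    using null_set_open_cover[OF assms] by auto
  define C where "C = space coin - U"
  have C: "C \<in> sets coin" using U(2) by (simp add: C_def del: space_coin)
  define S where "S = {s. emeasure coin (C \<inter> cylinder s) = 0}"
  define Z where "Z = (\<Union>s\<in>S. C \<inter> cylinder s)"
  have Z: "Z \<in> null_sets coin"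
    unfolding Z_def using C by (intro null_sets_UN') (auto simp: S_def null_sets_def)
  define K where "K = C - Z"
  have K: "K \<in> sets coin" using C Z by (auto simp: K_def)
  have inter: "emeasure coin (K \<inter> cylinder s) = emeasure coin (C \<inter> cylinder s)" for s
  proof -
    have "K \<inter> cylinder s = (C \<inter> cylinder s) - Z" by (auto simp: K_def)
    then show ?thesis using C Z by (simp add: emeasure_Diff_null_set)
  qed
  show thesis
  proof (rule that[OF K])
    have "measure coin U < 1" using U(4) by (simp add: coin.P.emeasure_eq_measure)
    then have "measure coin C \<noteq> 0" unfolding C_def using coin.P.prob_compl[OF U(2)] by simp
    moreover have "emeasure coin K = emeasure coin C"
      using inter[of "[]"] by (simp add: cylinder_def)
    ultimately have "emeasure coin K \<noteq> 0"
      by (simp add: coin.P.emeasure_eq_measure)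
    then show "K \<noteq> {}" by auto
  next
    fix s assume "K \<inter> cylinder s \<noteq> {}"
    then have "emeasure coin (C \<inter> cylinder s) \<noteq> 0" by (auto simp: K_def Z_def S_def)
    then have "measure coin (K \<inter> cylinder s) \<noteq> 0"
      using inter[of s] by (simp add: coin.P.emeasure_eq_measure)
    then show "measure coin (K \<inter> cylinder s) > 0"
      by (simp add: zero_less_measure_iff)
  next
    fix z assume meets: "\<And>m. K \<inter> cylinder (prefix m z) \<noteq> {}"
    show "z \<notin> B"
    proof
      assume "z \<in> B"
      then have "z \<in> U" using U(3) by auto
      then obtain m where "cylinder (prefix m z) \<subseteq> U" by (rule open_contains_cylinder[OF U(1)])
      then show False using meets[of m] by (auto simp: K_def C_def)
    qed
  qed
qed

lemma cantor_add_cancel [simp]: "cantor_add x (cantor_add x z) = z"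
  by (rule ext) (auto simp: cantor_add_def)

text \<open>
  This is the Baire category theorem, done by hand. If no cylinder works, then from any point of
  \<open>K\<close> one can move, keeping any given prefix, to a point of \<open>K\<close> whose translate by \<open>x\<close> lies in \<open>H n\<close>
  for some later \<open>n\<close>. The number \<open>b n\<close> bounds the coordinates that decide this, so keeping the first
  \<open>b n\<close> of them protects it. In the limit the translate lies in infinitely many \<open>H n\<close>, so the limit
  point is in \<open>B\<close>, although it is in the closure of \<open>K\<close>.
  
  The cylinder is chosen from a countable set that does not depend on \<open>x\<close>, and its length also
  serves as the index from which the sets \<open>H n\<close> are avoided.
\<close>

lemma baire_avoid_translate:
  fixes H :: "nat \<Rightarrow> cantor set"
  assumes "K \<noteq> {}"
    and K: "\<And>z. (\<And>m. K \<inter> cylinder (prefix m z) \<noteq> {}) \<Longrightarrow> z \<notin> B"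
    and b: "\<And>n. n < b n"
    and H: "\<And>n y z. (\<And>k. k < b n \<Longrightarrow> y k = z k) \<Longrightarrow> y \<in> H n \<longleftrightarrow> z \<in> H n"
    and x: "\<And>z. z \<in> limsup H \<Longrightarrow> cantor_add x z \<in> B"
  shows "\<exists>s. K \<inter> cylinder s \<noteq> {} \<and> (\<forall>z\<in>K \<inter> cylinder s. \<forall>n\<ge>length s. cantor_add x z \<notin> H n)"
proof (rule ccontr)
  assume contra: "\<not> ?thesis"
  have step: "\<exists>z'\<in>K. \<exists>n\<ge>m. (\<forall>k<m. z' k = z k) \<and> cantor_add x z' \<in> H n" if "z \<in> K" for z m
  proof -
    have "K \<inter> cylinder (prefix m z) \<noteq> {}" using that in_own_cylinder by blast
    then obtain z' n where "z' \<in> K \<inter> cylinder (prefix m z)" "n \<ge> m" "cantor_add x z' \<in> H n"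
      using contra by (metis length_prefix)
    then show ?thesis by (intro bexI[of _ z'] exI[of _ n]) (auto simp: in_cylinder_prefix_iff)
  qed
  \<comment> \<open>A state is a point of \<open>K\<close> with the length of the prefix to be kept from now on.\<close>
  define P where "P = (\<lambda>(_ :: nat) (a :: cantor \<times> nat). fst a \<in> K)"
  define Q where "Q = (\<lambda>(_ :: nat) (a :: cantor \<times> nat) (a' :: cantor \<times> nat).
    (\<forall>k<snd a. fst a' k = fst a k) \<and> (\<exists>n\<ge>snd a. snd a' = b n \<and> cantor_add x (fst a') \<in> H n))"
  have "\<exists>f. \<forall>i. P i (f i) \<and> Q i (f i) (f (Suc i))"
  proof (rule dependent_nat_choice)
    obtain z where "z \<in> K" using assms(1) by auto
    then show "\<exists>a. P 0 a" by (intro exI[of _ "(z, 0)"]) (simp add: P_def)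
  next
    fix a i assume "P i a"
    then have "fst a \<in> K" by (simp add: P_def)
    from step[OF this, of "snd a"] obtain z' n where
      "z' \<in> K" "n \<ge> snd a" "\<forall>k<snd a. z' k = fst a k" "cantor_add x z' \<in> H n" by auto
    then show "\<exists>a'. P (Suc i) a' \<and> Q i a a'"
      by (intro exI[of _ "(z', b n)"]) (auto simp: P_def Q_def)
  qed
  then obtain f where f: "\<And>i. P i (f i)" "\<And>i. Q i (f i) (f (Suc i))" by auto
  define z where "z i = fst (f i)" for i
  define m where "m i = snd (f i)" for i
  have z_K: "z i \<in> K" for i using f(1)[of i] by (simp add: P_def z_def)
  have z_Suc: "z (Suc i) k = z i k" if "k < m i" for i k
    using f(2)[of i] that by (simp add: Q_def z_def m_def)
  have H_Suc: "\<exists>n\<ge>m i. m (Suc i) = b n \<and> cantor_add x (z (Suc i)) \<in> H n" for i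
    using f(2)[of i] by (auto simp: Q_def z_def m_def)
  have m_Suc: "m i < m (Suc i)" for i
    using H_Suc[of i] b by (metis le_less_trans)
  then have mono: "strict_mono m" by (rule strict_mono_Suc_iff[THEN iffD2, rule_format])
  have agree: "z j k = z i k" if "i \<le> j" "k < m i" for i j k
    using that(1)
  proof (induction j rule: dec_induct)
    case (step j)
    have "m i \<le> m j" using mono step.hyps(1) by (simp add: strict_mono_less_eq)
    then show ?case using z_Suc[of k j] that(2) step.IH by simp
  qed simp
  \<comment> \<open>By stage \<open>Suc k\<close> coordinate \<open>k\<close> has become permanent, since \<open>m\<close> is strictly increasing.\<close>
  define w where "w k = z (Suc k) k" for k
  have w: "w k = z i k" if "k < m i" for i k
  proof (cases "i \<le> Suc k")
    case True
    then show ?thesis using agree[OF True that] by (simp add: w_def)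
  next
    case False
    have "Suc k \<le> m (Suc k)" using mono by (rule strict_mono_imp_increasing)
    then show ?thesis using agree[of "Suc k" i k] False by (simp add: w_def)
  qed
  have "w \<notin> B"
  proof (rule K)
    fix i
    have "i \<le> m i" using mono by (rule strict_mono_imp_increasing)
    then have "\<forall>k<i. z i k = w k" using w by (metis less_le_trans)
    then have "z i \<in> cylinder (prefix i w)" by (simp only: in_cylinder_prefix_iff)
    then show "K \<inter> cylinder (prefix i w) \<noteq> {}" using z_K[of i] by auto
  qed
  moreover have "cantor_add x w \<in> limsup H"
  proof -
    have "\<exists>n\<ge>i. cantor_add x w \<in> H n" for i
    proof -
      obtain n where n: "n \<ge> m i" "m (Suc i) = b n" "cantor_add x (z (Suc i)) \<in> H n"
        using H_Suc by auto
      have "cantor_add x w \<in> H n \<longleftrightarrow> cantor_add x (z (Suc i)) \<in> H n"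
        using w[of _ "Suc i"] n(2) by (intro H) (simp add: cantor_add_def)
      moreover have "i \<le> m i" using mono by (rule strict_mono_imp_increasing)
      ultimately show ?thesis using n by (intro exI[of _ n]) auto
    qed
    then show ?thesis by (auto simp: limsup_INF_SUP)
  qed
  ultimately show False using x[of "cantor_add x w"] by simp
qed

section \<open>Bounding the number of traces\<close>

text \<open>
  The translates of the level-\<open>n\<close> hash set by points with different traces on \<open>[F n, F n + l n)\<close> are
  pairwise independent events of measure \<open>1 / 2 ^ n\<close>, and different levels are independent because
  they use different coordinates. If from some level on there were always \<open>2 ^ n\<close> traces, then
  each level would contribute 1 to the expected number of events, and no set \<open>M\<close> of positive
  measure could avoid them all.
\<close>

lemma few_traces:
  fixes F l :: "nat \<Rightarrow> nat"
  assumes F: "\<And>n. F n + l n * Suc n + n \<le> F (Suc n)"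
    and M: "M \<in> sets coin" "measure coin M > 0"
    and avoid: "\<And>x z n. x \<in> Y \<Longrightarrow> z \<in> M \<Longrightarrow> n \<ge> m \<Longrightarrow> cantor_add x z \<notin> hash_set (F n) (l n) n"
  shows "\<exists>n\<ge>m. card ((\<lambda>x. map x [F n..<F n + l n]) ` Y) < 2 ^ n"
proof (rule ccontr)
  let ?tr = "\<lambda>n x :: cantor. map x [F n..<F n + l n]"
  assume "\<not> ?thesis"
  then have many: "2 ^ n \<le> card (?tr n ` Y)" if "n \<ge> m" for n using that by (auto simp: not_less)
  have "\<exists>V. V \<subseteq> Y \<and> card V = 2 ^ n \<and> inj_on (?tr n) V" if n: "n \<ge> m" for n
  proof -
    obtain T where T: "T \<subseteq> ?tr n ` Y" "card T = 2 ^ n"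
      using obtain_subset_with_card_n[OF many[OF n]] by metis
    then obtain V where "V \<subseteq> Y" "inj_on (?tr n) V" "T = ?tr n ` V"
      by (auto simp: subset_image_inj)
    then show ?thesis using T(2) card_image by metis
  qed
  then obtain V where V: "\<And>n. n \<ge> m \<Longrightarrow> V n \<subseteq> Y" "\<And>n. n \<ge> m \<Longrightarrow> card (V n) = 2 ^ n"
    "\<And>n. n \<ge> m \<Longrightarrow> inj_on (?tr n) (V n)" by metis
  have fin: "finite (V n)" if "n \<ge> m" for n
    using V(2)[OF that] by (intro card_ge_0_finite) simp
  have F_mono: "F i \<le> F j" if "i \<le> j" for i j
    using that by (rule lift_Suc_mono_le[rotated]) (meson F add_leE)
  define E where "E = (\<lambda>(n, x). hash_translate (F n) (l n) n x)"
  have prob_E: "measure coin (E a) = 1 / 2 ^ fst a" for a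
    by (simp add: E_def measure_hash_translate split: prod.split)
  have E_sets: "E a \<in> sets coin" for a by (simp add: E_def hash_translate_sets split: prod.split)
  have less: "measure coin (E (n, x) \<inter> E (n', x')) = measure coin (E (n, x)) * measure coin (E (n', x'))"
    if "n < n'" for n n' x x'
  proof -
    have "flip c z \<in> E (n, x) \<longleftrightarrow> z \<in> E (n, x)" if c: "F n' + l n' * Suc n' \<le> c" for c z
    proof -
      have "F (Suc n) \<le> F n'" using \<open>n < n'\<close> by (intro F_mono) simp
      then have "F n + l n * Suc n + n \<le> c" using F[of n] c by linarith
      then show ?thesis
        unfolding E_def hash_translate_def split mem_Collect_eq
        by (intro hash_set_cong) (simp add: cantor_add_def flip_def)
    qed
    then show ?thesis
      using measure_inter_hash_translate[OF E_sets[of "(n, x)"], of "F n'" "l n'" n' x']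
        prob_E[of "(n', x')"] by (simp add: E_def)
  qed
  have indep: "measure coin (E a \<inter> E a') = measure coin (E a) * measure coin (E a')"
    if J: "a \<in> Sigma {m..<r} V" "a' \<in> Sigma {m..<r} V" "a \<noteq> a'" for a a' r
  proof -
    obtain n x n' x' where a: "a = (n, x)" "a' = (n', x')" by (metis surj_pair)
    consider "n < n'" | "n' < n" | "n = n'" by linarith
    then show ?thesis
    proof cases
      case 1
      then show ?thesis unfolding a by (rule less)
    next
      case 2
      from less[OF this, of x' x] show ?thesis unfolding a by (simp add: Int_commute mult.commute)
    next
      case 3
      then have "?tr n x \<noteq> ?tr n x'"
        using J V(3)[of n] a by (auto dest: inj_onD)
      then obtain k where k: "F n \<le> k" "k < F n + l n" "x k \<noteq> x' k"
        unfolding map_eq_conv set_upt atLeastLessThan_iff Ball_def by metis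
      then show ?thesis
        using measure_hash_translate_pair[of "k - F n" "l n" x "F n" x' n] 3
        by (simp add: a E_def measure_hash_translate)
    qed
  qed
  have bound: "measure coin M * (real r)\<^sup>2 \<le> real r" for r :: nat
  proof -
    let ?J = "Sigma {m..<m + r} V"
    have "finite ?J" using fin by auto
    have "(\<Sum>a\<in>?J. measure coin (E a)) = (\<Sum>n\<in>{m..<m + r}. \<Sum>x\<in>V n. measure coin (E (n, x)))"
      using fin by (subst sum.Sigma) auto
    also have "\<dots> = (\<Sum>n\<in>{m..<m + r}. 1)"
      by (rule sum.cong) (auto simp: prob_E V(2))
    finally have sum: "(\<Sum>a\<in>?J. measure coin (E a)) = real r" by simp
    have disj: "M \<inter> E a = {}" if "a \<in> ?J" for a
      using that avoid V(1) by (fastforce simp: E_def hash_translate_def)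
    from prob_space.chebyshev_pairwise_independent[OF coin.P.prob_space_axioms \<open>finite ?J\<close>,
        of E M, OF E_sets M(1) indep disj]
    show ?thesis by (simp add: sum)
  qed
  obtain r :: nat where r: "real r > 1 / measure coin M" using reals_Archimedean2 by blast
  then have "real r > 0" using M(2) by (meson divide_pos_pos less_trans zero_less_one)
  moreover have "measure coin M * real r > 1" using r M(2) by (simp add: field_simps)
  ultimately have "measure coin M * real r * real r > 1 * real r" by (intro mult_strict_right_mono)
  then show False using bound[of r] by (simp add: power2_eq_square mult.assoc)
qed

section \<open>Sums with nowhere dense sets\<close>

lemma nowhere_dense_of_avoided_patterns:
  fixes S :: "cantor set"
  assumes "\<And>m. \<exists>p\<ge>m. \<exists>q w. \<forall>y\<in>S. \<exists>k\<in>{p..<q}. w k \<noteq> y k"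
  shows "nowhere_dense S"
  unfolding nowhere_dense_iff_cylinders
proof (intro allI)
  fix z :: cantor and m
  obtain p q w where p: "p \<ge> m" and w: "\<forall>y\<in>S. \<exists>k\<in>{p..<q}. w k \<noteq> y k"
    using assms by metis
  define x where "x k = (if k < p then z k else w k)" for k
  have "y \<notin> cylinder (prefix (max m q) x)" if y: "y \<in> S" for y
  proof -
    obtain k where "k \<in> {p..<q}" "w k \<noteq> y k" using w y by metis
    then have "k < max m q" "y k \<noteq> x k" by (auto simp: x_def)
    then show ?thesis unfolding in_cylinder_prefix_iff by metis
  qed
  then show "\<exists>y q. (\<forall>k<m. y k = z k) \<and> m \<le> q \<and> S \<inter> cylinder (prefix q y) = {}"
    using p by (intro exI[of _ x] exI[of _ "max m q"]) (auto simp: x_def)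
qed

text \<open>
  At a level where \<open>Y\<close> has fewer than \<open>2 ^ n\<close> traces, the translates of \<open>N\<close> by points of \<open>Y\<close> look on
  \<open>[F n, F n + l n)\<close> like fewer than \<open>2 ^ n\<close> translates, so a single pattern avoids all of them.
\<close>

lemma nowhere_dense_add_of_few_traces:
  fixes F l :: "nat \<Rightarrow> nat"
  assumes far: "\<And>n. n \<le> F (Suc n)"
    and avoid: "\<And>n (u :: nat \<Rightarrow> cantor). \<exists>w. \<forall>i<2 ^ n. \<forall>v\<in>N. \<exists>k\<in>{F n..<F n + l n}. w k \<noteq> cantor_add (u i) v k"
    and few: "\<And>m. \<exists>n\<ge>m. card ((\<lambda>x. map x [F n..<F n + l n]) ` Y) < 2 ^ n"
  shows "nowhere_dense (cantor_set_add Y N)"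
proof (rule nowhere_dense_of_avoided_patterns)
  fix m
  obtain n where n: "n \<ge> Suc m" and card: "card ((\<lambda>x. map x [F n..<F n + l n]) ` Y) < 2 ^ n"
    using few by metis
  let ?T = "(\<lambda>x. map x [F n..<F n + l n]) ` Y"
  have "finite ?T"
    by (rule finite_subset[OF _ finite_lists_length_eq[of "UNIV :: bool set" "l n"]]) auto
  then obtain h where h: "?T = h ` {i. i < card ?T}"
    using finite_imp_nat_seg_image_inj_on card_Collect_less_nat card_image by metis
  \<comment> \<open>The point \<open>u i\<close> has the \<open>i\<close>-th trace; its values outside the block do not matter.\<close>
  define u where "u i k = h i ! (k - F n)" for i k
  obtain w where w: "\<forall>i<2 ^ n. \<forall>v\<in>N. \<exists>k\<in>{F n..<F n + l n}. w k \<noteq> cantor_add (u i) v k"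
    using avoid by metis
  have "\<exists>k\<in>{F n..<F n + l n}. w k \<noteq> y k" if y: "y \<in> cantor_set_add Y N" for y
  proof -
    obtain x v where xv: "x \<in> Y" "v \<in> N" "y = cantor_add x v"
      using y by (auto simp: cantor_set_add_def)
    have "map x [F n..<F n + l n] \<in> h ` {i. i < card ?T}" using xv(1) h by blast
    then obtain i where i: "i < card ?T" "map x [F n..<F n + l n] = h i"
      unfolding image_iff mem_Collect_eq Bex_def by metis
    have same: "u i k = x k" if "k \<in> {F n..<F n + l n}" for k
    proof -
      have "k - F n < F n + l n - F n" "F n + (k - F n) = k" using that by auto
      then show ?thesis unfolding u_def i(2)[symmetric] by (simp only: nth_map_upt)
    qed
    obtain k where k: "k \<in> {F n..<F n + l n}" "w k \<noteq> cantor_add (u i) v k"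
      using w[rule_format, OF less_trans[OF i(1) card] xv(2)] by metis
    then show ?thesis using same[OF k(1)] by (intro bexI[of _ k]) (simp_all add: xv(3) cantor_add_def)
  qed
  moreover have "m \<le> F n" using n far[of "n - 1"] by (cases n) auto
  ultimately show "\<exists>p\<ge>m. \<exists>q w. \<forall>y\<in>cantor_set_add Y N. \<exists>k\<in>{p..<q}. w k \<noteq> y k"
    by (intro exI[of _ "F n"] conjI exI[of _ "F n + l n"] exI[of _ w]) simp_all
qed

text \<open>
  The null set given to null-additivity depends on \<open>N\<close>: the block lengths \<open>l n\<close> must be large
  enough for \<open>N\<close> to be avoided by \<open>2 ^ n\<close> translates simultaneously. The pieces \<open>Y s\<close> of \<open>X\<close>
  correspond to the cylinders produced by the Baire category argument.
\<close>

lemma null_additive_imp_meager_add_nowhere_dense: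
  assumes X: "null_additive X" and N: "nowhere_dense N"
  shows "meager (cantor_set_add X N)"
proof -
  define good where "good p n l \<longleftrightarrow>
    (\<forall>u :: nat \<Rightarrow> cantor. \<exists>w. \<forall>i<2 ^ n. \<forall>v\<in>N. \<exists>k\<in>{p..<p + l}. w k \<noteq> cantor_add (u i) v k)"
    for p n l :: nat
  have "\<exists>l. good p n l" for p n
  proof -
    obtain q where "q \<ge> p" and
      q: "\<forall>u :: nat \<Rightarrow> cantor. \<exists>w. \<forall>i<2 ^ n. \<forall>v\<in>N. \<exists>k\<in>{p..<q}. w k \<noteq> cantor_add (u i) v k"
      using nowhere_dense_avoid_translates[OF N, of p "2 ^ n"] by (elim exE conjE)
    then have "p + (q - p) = q" by simp
    then have "good p n (q - p)" unfolding good_def using q by simp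
    then show ?thesis ..
  qed
  then obtain L where L: "good p n (L p n)" for p n by metis
  \<comment> \<open>Level \<open>n\<close> occupies \<open>[F n, F (Suc n))\<close>: a vector, \<open>n\<close> rows and \<open>n\<close> further bits.\<close>
  define F :: "nat \<Rightarrow> nat" where "F = rec_nat 0 (\<lambda>n p. p + L p n * Suc n + n)"
  define l where "l n = L (F n) n" for n
  have F_Suc: "F (Suc n) = F n + l n * Suc n + n" for n by (simp add: F_def l_def)
  define H where "H n = hash_set (F n) (l n) n" for n
  have H_translate: "H n = hash_translate (F n) (l n) n (\<lambda>_. False)" for n
    by (simp add: H_def hash_translate_def cantor_add_def)
  have "limsup H \<in> null_sets coin"
  proof (rule borel_cantelli_limsup1)
    show "H n \<in> sets coin" for n by (simp add: H_translate hash_translate_sets)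
    show "emeasure coin (H n) < \<infinity>" for n by (simp add: coin.P.emeasure_eq_measure)
    have "(\<lambda>n. measure coin (H n)) = (\<lambda>n. (1 / 2) ^ n)"
      by (simp add: H_translate measure_hash_translate power_one_over)
    then show "summable (\<lambda>n. measure coin (H n))" by (simp add: summable_geometric)
  qed
  then have "cantor_null (limsup H)"
    by (simp add: cantor_null_def cantor_lebesgue_def coin_def[symmetric] null_sets_completionI)
  then have "cantor_null (cantor_set_add X (limsup H))"
    using X by (simp add: null_additive_def)
  then obtain B where B: "B \<in> null_sets coin" "cantor_set_add X (limsup H) \<subseteq> B"
    by (auto simp: cantor_null_def cantor_lebesgue_def coin_def[symmetric] null_sets_completion_iff2)
  obtain K where K: "K \<in> sets coin" "K \<noteq> {}"
    "\<And>s. K \<inter> cylinder s \<noteq> {} \<Longrightarrow> measure coin (K \<inter> cylinder s) > 0"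
    "\<And>z. (\<And>m. K \<inter> cylinder (prefix m z) \<noteq> {}) \<Longrightarrow> z \<notin> B"
    using self_supporting_set_avoiding_null_set[OF B(1)] by metis
  define Y where "Y s = {x \<in> X. K \<inter> cylinder s \<noteq> {} \<and>
    (\<forall>z\<in>K \<inter> cylinder s. \<forall>n\<ge>length s. cantor_add x z \<notin> H n)}" for s
  have "x \<in> (\<Union>s. Y s)" if x: "x \<in> X" for x
  proof -
    have "\<exists>s. K \<inter> cylinder s \<noteq> {} \<and> (\<forall>z\<in>K \<inter> cylinder s. \<forall>n\<ge>length s. cantor_add x z \<notin> H n)"
    proof (rule baire_avoid_translate[OF K(2), where b = "\<lambda>n. F (Suc n) + Suc n"])
      show "y \<in> H n \<longleftrightarrow> z \<in> H n" if "\<And>k. k < F (Suc n) + Suc n \<Longrightarrow> y k = z k" for n y z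
        unfolding H_def using that by (intro hash_set_cong) (simp add: F_Suc)
      show "cantor_add x z \<in> B" if "z \<in> limsup H" for z
        using B(2) x that by (auto simp: cantor_set_add_def)
    qed (use K(4) in simp_all)
    then show ?thesis using x by (auto simp: Y_def)
  qed
  then have X_eq: "X = (\<Union>s. Y s)" by (auto simp: Y_def)
  have "nowhere_dense (cantor_set_add (Y s) N)" for s
  proof (cases "K \<inter> cylinder s = {}")
    case True
    then show ?thesis by (simp add: Y_def cantor_set_add_def nowhere_dense_def)
  next
    case False
    have few: "\<exists>n\<ge>m. card ((\<lambda>x. map x [F n..<F n + l n]) ` Y s) < 2 ^ n" for m
    proof -
      have "\<exists>n\<ge>max m (length s). card ((\<lambda>x. map x [F n..<F n + l n]) ` Y s) < 2 ^ n"
      proof (rule few_traces)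
        show "K \<inter> cylinder s \<in> sets coin" using K(1) cylinder_sets by (rule sets.Int)
        show "measure coin (K \<inter> cylinder s) > 0" using False by (rule K(3))
        show "cantor_add x z \<notin> hash_set (F n) (l n) n"
          if "x \<in> Y s" "z \<in> K \<inter> cylinder s" "n \<ge> max m (length s)" for x z n
          using that by (simp add: Y_def H_def)
      qed (simp add: F_Suc)
      then show ?thesis by (metis max.boundedE)
    qed
    show ?thesis
      by (rule nowhere_dense_add_of_few_traces[OF _ _ few]) (use L in \<open>simp_all add: F_Suc l_def good_def\<close>)
  qed
  then have "meager (\<Union>s. cantor_set_add (Y s) N)"
    by (intro meager_countable_Union nowhere_dense_imp_meager)
  also have "(\<Union>s. cantor_set_add (Y s) N) = cantor_set_add X N"
    unfolding X_eq by (auto simp: cantor_set_add_def)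
  finally show ?thesis .
qed

theorem theorem2:
  fixes X :: "(nat \<Rightarrow> bool) set"
  assumes "null_additive X"
  shows "meager_additive X"
  unfolding meager_additive_def
proof (intro allI impI)
  fix A :: "cantor set"
  assume "meager A"
  then obtain N where N: "\<And>n :: nat. nowhere_dense (N n)" "A = (\<Union>n. N n)"
    unfolding meager_def by metis
  have "cantor_set_add X A = (\<Union>n. cantor_set_add X (N n))"
    by (auto simp: N(2) cantor_set_add_def)
  moreover have "meager (\<Union>n. cantor_set_add X (N n))"
    by (intro meager_countable_Union null_additive_imp_meager_add_nowhere_dense assms N(1))
  ultimately show "meager (cantor_set_add X A)" by simp
qed

end
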